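(* Let $G=([n],E)$ be a natural unit interval graph. Then the characteristic polynomial of the graphical arrangement $\mathcal{A}_G$ is $$\chi_{\mathcal{A}_G}(q)=\prod_{j=1}^n (q-c_j),$$ where $c_j=|\{i<j : \{i,j\}\in E\}|$ for all $j\in[n]$.
   Context: $[n]=\{1,\ldots,n\}$; graphs are finite, undirected, without loops or multiple edges. $G=([n],E)$ is a natural unit interval graph if for all $\{i,j\}\in E$ with $i<j$, one has $\{i,k\}\in E$ and $\{k,j\}\in E$ for all $i<k<j$. The graphical arrangement $\mathcal{A}_G$ is the collection of hyperplanes $\{x\in\mathbb{R}^n:x_i=x_j\}$ for $\{i,j\}\in E$. The characteristic polynomial of a hyperplane arrangement $\mathcal{A}$ in $\mathbb{R}^n$ is $\chi_{\mathcal{A}}(t)=\sum_{L\in\mathcal{L}_{\mathcal{A}}}\mu(\hat 0,L)\,t^{\dim L}$, where $\mathcal{L}_{\mathcal{A}}$ is the poset of non-empty intersections of hyperplanes of $\mathcal{A}$ ordered by reverse inclusion, with minimum element $\hat 0=\mathbb{R}^n$, and $\mu$ is its Möbius function. *)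

theory Defs
  imports "HOL-Computational_Algebra.Polynomial" "HOL-Library.Function_Algebras"
begin

definition simple_graph :: "nat \<Rightarrow> nat set set \<Rightarrow> bool" where
  "simple_graph n E \<longleftrightarrow> (\<forall>e\<in>E. \<exists>i\<in>{1..n}. \<exists>j\<in>{1..n}. i \<noteq> j \<and> e = {i, j})"

definition natural_unit_interval_graph :: "nat \<Rightarrow> nat set set \<Rightarrow> bool" where
  "natural_unit_interval_graph n E \<longleftrightarrow>
     simple_graph n E \<and>
     (\<forall>i j. {i, j} \<in> E \<and> i < j \<longrightarrow>
        (\<forall>k. i < k \<and> k < j \<longrightarrow> {i, k} \<in> E \<and> {k, j} \<in> E))"

text \<open>Vectors are functions on \<^typ>\<open>nat\<close> with coordinates in \<open>{1..n}\<close> and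
  vanishing at every other index; addition is the pointwise one of
  \<^theory>\<open>HOL-Library.Function_Algebras\<close>.\<close>

definition Rn :: "nat \<Rightarrow> (nat \<Rightarrow> real) set" where
  "Rn n = {x. \<forall>i. i \<notin> {1..n} \<longrightarrow> x i = 0}"

definition fscale :: "real \<Rightarrow> (nat \<Rightarrow> real) \<Rightarrow> nat \<Rightarrow> real" where
  "fscale c x = (\<lambda>i. c * x i)"

interpretation rfun: vector_space fscale
  by unfold_locales (auto simp: fscale_def fun_eq_iff algebra_simps)

text \<open>The dimension of a non-empty affine subspace is the dimension of its direction, i.e. of
  the linear subspace of differences of its points. (For a linear subspace the direction is
  the subspace itself.)\<close>

definition flat_dim :: "(nat \<Rightarrow> real) set \<Rightarrow> nat" where
  "flat_dim L = rfun.dim {x - y | x y. x \<in> L \<and> y \<in> L}"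

text \<open>The empty subfamily contributes the whole space \<^term>\<open>Rn n\<close>.\<close>

definition intersection_poset ::
    "nat \<Rightarrow> (nat \<Rightarrow> real) set set \<Rightarrow> (nat \<Rightarrow> real) set set" where
  "intersection_poset n A = {L. L \<noteq> {} \<and> (\<exists>B\<subseteq>A. L = Rn n \<inter> \<Inter>B)}"

text \<open>The Moebius function of a finite family \<^term>\<open>P\<close> of sets ordered by reverse
  inclusion, so that \<^term>\<open>Z \<subset> Y\<close> means that \<^term>\<open>Y\<close> is strictly below
  \<^term>\<open>Z\<close>. The finiteness test only serves to make the recursion well-founded.\<close>

function moebius :: "'a set set \<Rightarrow> 'a set \<Rightarrow> 'a set \<Rightarrow> int" where
  "moebius P X Z =
     (if X = Z then 1
      else if Z \<subset> X \<and> finite P then - (\<Sum>Y\<in>{Y\<in>P. Z \<subset> Y \<and> Y \<subseteq> X}. moebius P X Y)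
      else 0)"
  by auto
termination
proof (relation "measure (\<lambda>(P, X, Z). card {W\<in>P. Z \<subset> W})", goal_cases)
  case 1
  show ?case by simp
next
  case (2 P X Z Y)
  then have "{W\<in>P. Y \<subset> W} \<subset> {W\<in>P. Z \<subset> W}" by auto
  with 2 show ?case by (simp add: psubset_card_mono)
qed

declare moebius.simps [simp del]

definition characteristic_poly :: "nat \<Rightarrow> (nat \<Rightarrow> real) set set \<Rightarrow> int poly" where
  "characteristic_poly n A =
     (\<Sum>L\<in>intersection_poset n A.
        monom (moebius (intersection_poset n A) (Rn n) L) (flat_dim L))"

definition graphical_arrangement :: "nat \<Rightarrow> nat set set \<Rightarrow> (nat \<Rightarrow> real) set set" where
  "graphical_arrangement n E = {{x \<in> Rn n. x i = x j} | i j. {i, j} \<in> E}"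

end

theory Submission imports Defs "HOL-Library.FuncSet" begin

text \<open>At a natural number \<open>q\<close> the characteristic polynomial counts the proper colourings of the
  graph with \<open>q\<close> colours: a flat of dimension \<open>d\<close> contains \<open>q ^ d\<close> colourings, and Moebius
  inversion leaves only the colourings that lie on no hyperplane. In a natural unit interval graph
  the smaller neighbours of a vertex \<open>j\<close> form a clique, so when the vertices are coloured in
  increasing order exactly \<open>q - c j\<close> colours are available for \<open>j\<close>.\<close>

text \<open>Colours are real numbers, so that a colouring is a point of \<open>Rn n\<close> and can
  lie on a hyperplane or in a flat.\<close>

definition colourings :: "nat \<Rightarrow> real set \<Rightarrow> (nat \<Rightarrow> real) set" where
  "colourings n K = {x \<in> Rn n. \<forall>i\<in>{1..n}. x i \<in> K}"

text \<open>Both indices are bounded by \<open>n\<close>, so that a smaller number in place of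
  \<open>n\<close>, with the same \<open>E\<close>, gives the proper colourings of an induced
  subgraph on an initial segment of the vertices.\<close>

definition proper_colourings :: "nat \<Rightarrow> nat set set \<Rightarrow> real set \<Rightarrow> (nat \<Rightarrow> real) set" where
  "proper_colourings n E K =
     {x \<in> colourings n K. \<forall>i\<in>{1..n}. \<forall>j\<in>{1..n}. {i, j} \<in> E \<longrightarrow> x i \<noteq> x j}"

lemma simple_graph_edgeD:
  assumes "simple_graph n E" "{i, j} \<in> E"
  shows "i \<in> {1..n}" "j \<in> {1..n}" "i \<noteq> j"
  using assms by (fastforce simp: simple_graph_def doubleton_eq_iff)+

section \<open>Subspaces given by equalities of coordinates\<close>

text \<open>The map \<open>m\<close> is meant to be idempotent on \<open>{1..n}\<close> and to send
  each index to the representative of its block; the space then consists of the vectors that are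
  constant on blocks.\<close>

definition block_space :: "nat \<Rightarrow> (nat \<Rightarrow> nat) \<Rightarrow> (nat \<Rightarrow> real) set" where
  "block_space n m = {x \<in> Rn n. \<forall>i\<in>{1..n}. x i = x (m i)}"

lemma sum_fun_apply: "(\<Sum>a\<in>A. f a) i = (\<Sum>a\<in>A. f a i)"
  for f :: "'a \<Rightarrow> 'b \<Rightarrow> 'c::comm_monoid_add"
  by (induction A rule: infinite_finite_induct) auto

lemma subspace_block_space: "rfun.subspace (block_space n m)"
  unfolding rfun.subspace_def by (auto simp: block_space_def Rn_def fscale_def)

lemma flat_dim_subspace:
  assumes "rfun.subspace L"
  shows "flat_dim L = rfun.dim L"
proof -
  have "x \<in> {x - y | x y. x \<in> L \<and> y \<in> L}" if "x \<in> L" for x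
    using that rfun.subspace_0[OF assms] by (metis (mono_tags, lifting) diff_zero mem_Collect_eq)
  then have "{x - y | x y. x \<in> L \<and> y \<in> L} = L"
    using rfun.subspace_diff[OF assms] by auto
  then show ?thesis by (simp add: flat_dim_def)
qed

text \<open>The indicator vectors of the blocks form a basis, and there is one block for each
  representative in the image of \<open>m\<close>.\<close>

lemma dim_block_space:
  assumes m: "\<And>i. i \<in> {1..n} \<Longrightarrow> m i \<in> {1..n}"
    and idem: "\<And>i. i \<in> {1..n} \<Longrightarrow> m (m i) = m i"
  shows "rfun.dim (block_space n m) = card (m ` {1..n})"
proof -
  define S where "S = m ` {1..n}"
  define e :: "nat \<Rightarrow> nat \<Rightarrow> real" where
    "e s i = (if i \<in> {1..n} \<and> m i = s then 1 else 0)" for s i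
  have S: "s \<in> {1..n}" "m s = s" if "s \<in> S" for s
    using that m idem by (auto simp: S_def)
  have fin: "finite S" by (simp add: S_def)
  have e_S: "e s t = (if s = t then 1 else 0)" if "s \<in> S" "t \<in> S" for s t
    using S that by (auto simp: e_def)
  have inj: "inj_on e S"
    by (rule inj_onI) (metis e_S zero_neq_one)
  have "e s \<in> block_space n m" for s
    unfolding block_space_def Rn_def e_def using m idem by auto
  then have sub: "e ` S \<subseteq> block_space n m" by blast
  have span: "block_space n m \<subseteq> rfun.span (e ` S)"
  proof
    fix x assume x: "x \<in> block_space n m"
    have "x = (\<Sum>s\<in>S. fscale (x s) (e s))"
    proof
      fix i
      show "x i = (\<Sum>s\<in>S. fscale (x s) (e s)) i"
      proof (cases "i \<in> {1..n}")
        case True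
        then have "m i \<in> S" by (simp add: S_def)
        moreover have "(\<Sum>s\<in>S. fscale (x s) (e s)) i = (\<Sum>s\<in>S. if s = m i then x s else 0)"
          unfolding sum_fun_apply by (rule sum.cong) (use True in \<open>auto simp: fscale_def e_def\<close>)
        ultimately show ?thesis using x True fin by (simp add: block_space_def)
      next
        case False
        then show ?thesis
          using x unfolding sum_fun_apply by (auto simp: fscale_def e_def block_space_def Rn_def)
      qed
    qed
    also have "\<dots> \<in> rfun.span (e ` S)"
      by (intro rfun.span_sum rfun.span_scale rfun.span_base) auto
    finally show "x \<in> rfun.span (e ` S)" .
  qed
  have "rfun.independent (e ` S)"
  proof (rule rfun.independent_if_scalars_zero)
    show "finite (e ` S)" using fin by simp
    fix f v assume *: "(\<Sum>v\<in>e ` S. fscale (f v) v) = 0" and "v \<in> e ` S"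
    then obtain t where t: "t \<in> S" "v = e t" by blast
    \<comment> \<open>Evaluation at the representative \<open>t\<close> isolates the coefficient of
      \<open>e t\<close>, since every other indicator vanishes there.\<close>
    have "0 = (\<Sum>s\<in>S. fscale (f (e s)) (e s)) t"
      using * by (simp add: sum.reindex[OF inj])
    also have "\<dots> = (\<Sum>s\<in>S. if s = t then f (e s) else 0)"
      unfolding sum_fun_apply by (rule sum.cong) (use t e_S in \<open>auto simp: fscale_def\<close>)
    finally show "f v = 0" using t fin by simp
  qed
  then have "card (e ` S) = rfun.dim (block_space n m)"
    by (rule rfun.basis_card_eq_dim[OF sub span])
  then show ?thesis using card_image[OF inj] by (simp add: S_def)
qed

text \<open>A colouring that is constant on blocks is determined by its values at the
  representatives, and these can be chosen freely in \<open>K\<close>.\<close>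

lemma card_colourings_block_space:
  assumes m: "\<And>i. i \<in> {1..n} \<Longrightarrow> m i \<in> {1..n}"
    and idem: "\<And>i. i \<in> {1..n} \<Longrightarrow> m (m i) = m i"
  shows "card (block_space n m \<inter> colourings n K) = card K ^ card (m ` {1..n})"
proof -
  define S where "S = m ` {1..n}"
  have S: "s \<in> {1..n}" "m s = s" if "s \<in> S" for s
    using that m idem by (auto simp: S_def)
  have mS: "m i \<in> S" if "i \<in> {1..n}" for i using that by (simp add: S_def)
  \<comment> \<open>The inverse spreads the colour of a representative over its block; the value 0
    outside \<open>{1..n}\<close> keeps the result in \<open>Rn n\<close>.\<close>
  have "bij_betw (\<lambda>x. restrict x S) (block_space n m \<inter> colourings n K) (S \<rightarrow>\<^sub>E K)"
  proof (rule bij_betw_byWitness[where f' = "\<lambda>y i. if i \<in> {1..n} then y (m i) else 0"])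
    show "\<forall>x\<in>block_space n m \<inter> colourings n K.
        (\<lambda>i. if i \<in> {1..n} then restrict x S (m i) else 0) = x"
      using mS by (auto simp: block_space_def Rn_def fun_eq_iff)
    show "\<forall>y\<in>S \<rightarrow>\<^sub>E K. restrict (\<lambda>i. if i \<in> {1..n} then y (m i) else 0) S = y"
      using S by (auto simp: fun_eq_iff restrict_def PiE_def extensional_def)
    show "(\<lambda>x. restrict x S) ` (block_space n m \<inter> colourings n K) \<subseteq> S \<rightarrow>\<^sub>E K"
      using S by (auto simp: colourings_def)
    show "(\<lambda>y i. if i \<in> {1..n} then y (m i) else 0) ` (S \<rightarrow>\<^sub>E K)
        \<subseteq> block_space n m \<inter> colourings n K"
    proof clarify
      fix y assume y: "y \<in> S \<rightarrow>\<^sub>E K"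
      have "y (m i) \<in> K" if "i \<in> {1..n}" for i
        using y mS[OF that] by auto
      then show "(\<lambda>i. if i \<in> {1..n} then y (m i) else 0) \<in> block_space n m \<inter> colourings n K"
        using m idem unfolding block_space_def colourings_def Rn_def by auto
    qed
  qed
  then have "card (block_space n m \<inter> colourings n K) = card (S \<rightarrow>\<^sub>E K)"
    by (rule bij_betw_same_card)
  also have "\<dots> = card K ^ card S" by (simp add: card_PiE S_def)
  finally show ?thesis by (simp add: S_def)
qed

text \<open>Agreement of two coordinates on all of \<open>L\<close> is an equivalence relation on
  the indices, and \<open>m\<close> picks the least element of each class.\<close>

lemma flat_is_block_space:
  assumes E: "simple_graph n E"
    and L: "L \<in> intersection_poset n (graphical_arrangement n E)"
  obtains m where "L = block_space n m"
    "\<And>i. i \<in> {1..n} \<Longrightarrow> m i \<in> {1..n}" "\<And>i. i \<in> {1..n} \<Longrightarrow> m (m i) = m i"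
proof -
  obtain B where B: "B \<subseteq> graphical_arrangement n E" "L = Rn n \<inter> \<Inter>B"
    using L by (auto simp: intersection_poset_def)
  define same where "same i j \<longleftrightarrow> j \<in> {1..n} \<and> (\<forall>x\<in>L. x j = x i)" for i j
  define m where "m i = (LEAST j. same i j)" for i
  have same_m: "same i (m i)" if "i \<in> {1..n}" for i
    unfolding m_def by (rule LeastI[of _ i]) (use that in \<open>auto simp: same_def\<close>)
  \<comment> \<open>Indices that agree on \<open>L\<close> satisfy the same predicate
    \<open>same\<close>, hence have the same least witness.\<close>
  have m_cong: "m i = m j" if "\<And>x. x \<in> L \<Longrightarrow> x i = x j" for i j
    unfolding m_def same_def using that by (intro arg_cong[of _ _ Least] ext) metis
  have "x i = x (m i)" if "x \<in> L" "i \<in> {1..n}" for x i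
    using same_m[OF that(2)] that(1) unfolding same_def by metis
  then have "L \<subseteq> block_space n m"
    using B(2) unfolding block_space_def by blast
  moreover have "block_space n m \<subseteq> L"
  proof
    fix x assume x: "x \<in> block_space n m"
    have "x \<in> H" if "H \<in> B" for H
    proof -
      obtain i j where ij: "H = {x \<in> Rn n. x i = x j}" "{i, j} \<in> E"
        using B(1) \<open>H \<in> B\<close> by (auto simp: graphical_arrangement_def)
      then have "i \<in> {1..n}" "j \<in> {1..n}"
        using simple_graph_edgeD[OF E] by blast+
      \<comment> \<open>The hyperplane \<open>H\<close> contains \<open>L\<close>, so the
        coordinates \<open>i\<close> and \<open>j\<close> agree on \<open>L\<close>.\<close>
      moreover have "m i = m j"
        by (rule m_cong) (use ij B(2) \<open>H \<in> B\<close> in auto)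
      ultimately show ?thesis using x ij(1) by (auto simp: block_space_def)
    qed
    then show "x \<in> L" using x B(2) by (auto simp: block_space_def)
  qed
  moreover have "m (m i) = m i" if "i \<in> {1..n}" for i
    by (rule m_cong) (use same_m[OF that] in \<open>simp add: same_def\<close>)
  moreover have "m i \<in> {1..n}" if "i \<in> {1..n}" for i
    using same_m[OF that] by (simp add: same_def)
  ultimately show ?thesis using that by blast
qed

section \<open>Moebius inversion over the flats\<close>

lemma finite_colourings:
  assumes "finite K"
  shows "finite (colourings n K)"
proof (rule finite_subset)
  show "colourings n K \<subseteq> {x. \<forall>i. (i \<in> {1..n} \<longrightarrow> x i \<in> K) \<and> (i \<notin> {1..n} \<longrightarrow> x i = 0)}"
    by (auto simp: colourings_def Rn_def)
qed (use assms in \<open>intro finite_set_of_finite_funs; simp\<close>)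

lemma finite_intersection_poset:
  assumes "finite A"
  shows "finite (intersection_poset n A)"
  by (rule finite_subset[of _ "(\<lambda>B. Rn n \<inter> \<Inter>B) ` Pow A"])
    (use assms in \<open>auto simp: intersection_poset_def\<close>)

lemma finite_graphical_arrangement:
  assumes "simple_graph n E"
  shows "finite (graphical_arrangement n E)"
proof (rule finite_subset)
  show "graphical_arrangement n E
      \<subseteq> (\<lambda>(i, j). {x \<in> Rn n. x i = x j}) ` ({1..n} \<times> {1..n})"
    using assms by (fastforce simp: graphical_arrangement_def simple_graph_def doubleton_eq_iff)
qed simp

lemma Rn_in_intersection_poset: "Rn n \<in> intersection_poset n A"
proof -
  have "0 \<in> Rn n" by (simp add: Rn_def)
  then show ?thesis by (auto simp: intersection_poset_def intro!: exI[of _ "{}"])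
qed

text \<open>This is the recursion of \<open>moebius\<close> with the term for \<open>Z\<close> moved
  to the side of the sum; under reverse inclusion the index set is the interval from
  \<open>X\<close> to \<open>Z\<close>.\<close>

lemma sum_moebius_above:
  assumes "finite P" "X \<in> P" "Z \<in> P" "Z \<subseteq> X"
  shows "(\<Sum>Y\<in>{Y\<in>P. Z \<subseteq> Y \<and> Y \<subseteq> X}. moebius P X Y) = (if Z = X then 1 else 0)"
proof (cases "Z = X")
  case True
  then have "{Y\<in>P. Z \<subseteq> Y \<and> Y \<subseteq> X} = {X}" using assms by auto
  then show ?thesis using True by (simp add: moebius.simps)
next
  case False
  have "{Y\<in>P. Z \<subseteq> Y \<and> Y \<subseteq> X} = insert Z {Y\<in>P. Z \<subset> Y \<and> Y \<subseteq> X}"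
    using assms by auto
  then have "(\<Sum>Y\<in>{Y\<in>P. Z \<subseteq> Y \<and> Y \<subseteq> X}. moebius P X Y)
      = moebius P X Z + (\<Sum>Y\<in>{Y\<in>P. Z \<subset> Y \<and> Y \<subseteq> X}. moebius P X Y)"
    using assms(1) by simp
  also have "moebius P X Z = - (\<Sum>Y\<in>{Y\<in>P. Z \<subset> Y \<and> Y \<subseteq> X}. moebius P X Y)"
    using False assms by (subst moebius.simps) auto
  finally show ?thesis using False by simp
qed

text \<open>The flats through \<open>x\<close> form the interval from \<open>Rn n\<close> to the
  smallest such flat. The Moebius values over it cancel unless that flat is \<open>Rn n\<close>
  itself, that is, unless \<open>x\<close> avoids every hyperplane.\<close>

lemma sum_moebius_containing:
  assumes "finite A" "x \<in> Rn n" and proper: "\<And>H. H \<in> A \<Longrightarrow> \<not> Rn n \<subseteq> H"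
  shows "(\<Sum>L\<in>{L \<in> intersection_poset n A. x \<in> L}. moebius (intersection_poset n A) (Rn n) L)
    = (if x \<in> \<Union>A then 0 else 1)"
proof -
  define P where "P = intersection_poset n A"
  \<comment> \<open>the smallest flat through \<open>x\<close>\<close>
  define Z where "Z = Rn n \<inter> \<Inter>{H\<in>A. x \<in> H}"
  have "x \<in> Z" using assms(2) by (simp add: Z_def)
  then have "Z \<in> P" by (auto simp: P_def Z_def intersection_poset_def)
  have "x \<in> L \<longleftrightarrow> Z \<subseteq> L \<and> L \<subseteq> Rn n" if "L \<in> P" for L
    using that \<open>x \<in> Z\<close> by (auto simp: P_def Z_def intersection_poset_def)
  then have "{L \<in> P. x \<in> L} = {L \<in> P. Z \<subseteq> L \<and> L \<subseteq> Rn n}" by auto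
  \<comment> \<open>If \<open>Z\<close> is the whole space, a hyperplane through \<open>x\<close>
    would contain \<open>Rn n\<close>, which \<open>proper\<close> excludes.\<close>
  moreover have "Z = Rn n \<longleftrightarrow> x \<notin> \<Union>A"
    using proper by (auto simp: Z_def)
  ultimately show ?thesis
    using sum_moebius_above[of P "Rn n" Z] \<open>Z \<in> P\<close> finite_intersection_poset[OF assms(1)]
    by (auto simp: P_def Z_def Rn_in_intersection_poset)
qed

text \<open>Double counting: each power of \<open>card K\<close> becomes the number of colourings in
  a flat, and after exchanging the sums each colouring carries the Moebius sum over the flats
  through it.\<close>

lemma poly_characteristic_poly:
  assumes E: "simple_graph n E" and K: "finite K"
  shows "poly (characteristic_poly n (graphical_arrangement n E)) (int (card K))
    = int (card (proper_colourings n E K))"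
proof -
  define A where "A = graphical_arrangement n E"
  define P where "P = intersection_poset n A"
  define C where "C = colourings n K"
  have finA: "finite A" using E by (simp add: A_def finite_graphical_arrangement)
  have finP: "finite P" using finA by (simp add: P_def finite_intersection_poset)
  have finC: "finite C" using K by (simp add: C_def finite_colourings)
  have CRn: "C \<subseteq> Rn n" by (auto simp: C_def colourings_def)
  note edge = simple_graph_edgeD[OF E]
  have proper: "\<not> Rn n \<subseteq> H" if "H \<in> A" for H
  proof -
    obtain i j where ij: "H = {x \<in> Rn n. x i = x j}" "{i, j} \<in> E"
      using \<open>H \<in> A\<close> by (auto simp: A_def graphical_arrangement_def)
    \<comment> \<open>The unit vector at \<open>i\<close> separates the coordinates \<open>i\<close>
      and \<open>j\<close>, as an edge has distinct end points.\<close>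
    have "(\<lambda>k. if k = i then 1 else 0) \<in> Rn n - H"
      using edge[OF ij(2)] ij(1) by (auto simp: Rn_def)
    then show ?thesis by blast
  qed
  have flat: "card K ^ flat_dim L = card (L \<inter> C)" if "L \<in> P" for L
  proof -
    obtain m where m: "L = block_space n m"
      "\<And>i. i \<in> {1..n} \<Longrightarrow> m i \<in> {1..n}" "\<And>i. i \<in> {1..n} \<Longrightarrow> m (m i) = m i"
      using flat_is_block_space[OF E] \<open>L \<in> P\<close> unfolding P_def A_def by metis
    show ?thesis
      unfolding C_def m(1) flat_dim_subspace[OF subspace_block_space]
      using dim_block_space[of n m] card_colourings_block_space[of n m K] m(2,3) by simp
  qed
  have "poly (characteristic_poly n A) (int (card K))
      = (\<Sum>L\<in>P. moebius P (Rn n) L * int (card K ^ flat_dim L))"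
    by (simp add: characteristic_poly_def P_def poly_sum poly_monom)
  also have "\<dots> = (\<Sum>L\<in>P. \<Sum>x\<in>{x\<in>C. x \<in> L}. moebius P (Rn n) L)"
    by (rule sum.cong) (auto simp: flat Int_def conj_commute simp del: of_nat_power)
  also have "\<dots> = (\<Sum>x\<in>C. \<Sum>L\<in>{L\<in>P. x \<in> L}. moebius P (Rn n) L)"
    by (rule sum.swap_restrict[OF finP finC])
  also have "\<dots> = (\<Sum>x\<in>C. if x \<in> \<Union>A then 0 else 1)"
    unfolding P_def
    by (rule sum.cong[OF refl], rule sum_moebius_containing[OF finA]) (use CRn proper in auto)
  also have "\<dots> = int (card {x\<in>C. x \<notin> \<Union>A})"
    using finC by (simp add: sum.If_cases Int_def)
  also have "{x\<in>C. x \<notin> \<Union>A} = proper_colourings n E K"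
  proof -
    have "x \<in> \<Union>A \<longleftrightarrow> (\<exists>i j. {i, j} \<in> E \<and> x i = x j)" if "x \<in> C" for x
      using that CRn by (auto simp: A_def graphical_arrangement_def)
    then show ?thesis
      using edge unfolding proper_colourings_def C_def[symmetric] by blast
  qed
  finally show ?thesis by (simp add: A_def)
qed

section \<open>Counting proper colourings\<close>

text \<open>The smaller neighbours \<open>N\<close> of \<open>Suc k\<close> form a clique, so a
  proper colouring of the first \<open>k\<close> vertices uses \<open>card N\<close> distinct
  colours on them, and the remaining colours of \<open>K\<close> are exactly those available for
  \<open>Suc k\<close>.\<close>

lemma card_proper_colourings_Suc:
  assumes E: "natural_unit_interval_graph n E" and K: "finite K" and k: "Suc k \<le> n"
  shows "int (card (proper_colourings (Suc k) E K)) = int (card (proper_colourings k E K)) *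
    (int (card K) - int (card {i. i < Suc k \<and> {i, Suc k} \<in> E}))"
proof -
  define N where "N = {i. i < Suc k \<and> {i, Suc k} \<in> E}"
  define PC where "PC = proper_colourings k E K"
  have simple: "simple_graph n E" using E by (simp add: natural_unit_interval_graph_def)
  note edge = simple_graph_edgeD[OF simple]
  have N: "N \<subseteq> {1..k}" using edge(1)[of _ "Suc k"] by (auto simp: N_def)
  then have finN: "finite N" by (rule finite_subset) simp
  \<comment> \<open>The interval condition is applied to the edge \<open>{i, Suc k}\<close> and the
    intermediate vertex \<open>j\<close>.\<close>
  have clique: "{i, j} \<in> E" if "i \<in> N" "j \<in> N" "i < j" for i j
    using that E unfolding N_def natural_unit_interval_graph_def by blast
  have finPC: "finite PC"
    using finite_colourings[OF K] by (simp add: PC_def proper_colourings_def)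
  have inj: "inj_on x N" if "x \<in> PC" for x
  proof (rule linorder_inj_onI)
    fix i j assume "i < j" "i \<in> N" "j \<in> N"
    then show "x i \<noteq> x j"
      using clique[of i j] N that unfolding PC_def proper_colourings_def by blast
  qed auto
  have sub: "x ` N \<subseteq> K" if "x \<in> PC" for x
    using that N unfolding PC_def proper_colourings_def colourings_def by blast
  have "bij_betw (\<lambda>(x, a). x(Suc k := a)) (SIGMA x:PC. K - x ` N)
      (proper_colourings (Suc k) E K)"
  \<comment> \<open>The inverse splits off the colour of \<open>Suc k\<close> and resets that
    coordinate to 0, as membership in \<open>Rn k\<close> demands.\<close>
  proof (rule bij_betw_byWitness[where f' = "\<lambda>y. (y(Suc k := 0), y (Suc k))"])
    show "\<forall>p\<in>SIGMA x:PC. K - x ` N. (\<lambda>y. (y(Suc k := 0), y (Suc k)))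
        ((\<lambda>(x, a). x(Suc k := a)) p) = p"
      by (auto simp: PC_def proper_colourings_def colourings_def Rn_def fun_eq_iff)
    show "\<forall>y\<in>proper_colourings (Suc k) E K.
        (\<lambda>(x, a). x(Suc k := a)) (y(Suc k := 0), y (Suc k)) = y"
      by simp
    show "(\<lambda>(x, a). x(Suc k := a)) ` (SIGMA x:PC. K - x ` N)
        \<subseteq> proper_colourings (Suc k) E K"
    proof clarify
      fix x a assume x: "x \<in> PC" and a: "a \<in> K" "a \<notin> x ` N"
      have "(x(Suc k := a)) i \<noteq> (x(Suc k := a)) j"
        if ij: "i \<in> {1..Suc k}" "j \<in> {1..Suc k}" "{i, j} \<in> E" for i j
      proof -
        have "i \<noteq> j" using edge(3) ij(3) by blast
        consider "i = Suc k" "j \<in> N" | "j = Suc k" "i \<in> N" | "i \<in> {1..k}" "j \<in> {1..k}"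
        proof (cases "i = Suc k \<or> j = Suc k")
          case True
          then show ?thesis using ij \<open>i \<noteq> j\<close> that(1,2) by (auto simp: N_def insert_commute)
        qed (use ij that(3) in auto)
        then show ?thesis
          using a(2) ij(3) x \<open>i \<noteq> j\<close> by cases (auto simp: PC_def proper_colourings_def)
      qed
      moreover have "x(Suc k := a) \<in> colourings (Suc k) K"
        using x a(1) by (auto simp: PC_def proper_colourings_def colourings_def Rn_def)
      ultimately show "x(Suc k := a) \<in> proper_colourings (Suc k) E K"
        unfolding proper_colourings_def by blast
    qed
    show "(\<lambda>y. (y(Suc k := 0), y (Suc k))) ` proper_colourings (Suc k) E K
        \<subseteq> (SIGMA x:PC. K - x ` N)"
    proof clarify
      fix y assume y: "y \<in> proper_colourings (Suc k) E K"
      have "y(Suc k := 0) \<in> PC"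
        using y by (auto simp: PC_def proper_colourings_def colourings_def Rn_def)
      moreover have "y (Suc k) \<in> K"
        using y by (auto simp: proper_colourings_def colourings_def)
      moreover have "y (Suc k) \<noteq> y i" if "i \<in> N" for i
      proof -
        have "i \<in> {1..Suc k}" "{i, Suc k} \<in> E" using that N by (auto simp: N_def)
        then have "y i \<noteq> y (Suc k)" using y by (auto simp: proper_colourings_def)
        then show ?thesis by simp
      qed
      moreover have "(y(Suc k := 0)) ` N = y ` N"
        by (rule image_cong) (auto simp: N_def)
      ultimately show "y(Suc k := 0) \<in> PC \<and> y (Suc k) \<in> K - (y(Suc k := 0)) ` N"
        by auto
    qed
  qed
  then have "card (proper_colourings (Suc k) E K) = card (SIGMA x:PC. K - x ` N)"
    by (simp add: bij_betw_same_card)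
  also have "\<dots> = (\<Sum>x\<in>PC. card (K - x ` N))"
    using finPC K by simp
  also have "int \<dots> = (\<Sum>x\<in>PC. int (card K) - int (card N))"
    unfolding of_nat_sum
  proof (rule sum.cong[OF refl])
    fix x assume x: "x \<in> PC"
    \<comment> \<open>A single proper colouring \<open>x\<close> forces \<open>card N\<close> \<le>
      \<open>card K\<close>, so natural and integer subtraction agree. If there is no such
      \<open>x\<close>, both sums are empty, even when the integer difference is negative.\<close>
    have "card (x ` N) \<le> card K" using K sub[OF x] by (rule card_mono)
    then show "int (card (K - x ` N)) = int (card K) - int (card N)"
      using card_Diff_subset[OF finite_imageI[OF finN] sub[OF x]] card_image[OF inj[OF x]]
      by simp
  qed
  finally show ?thesis by (simp add: PC_def N_def)
qed

text \<open>The induction adds vertices in increasing order while \<open>E\<close> and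
  \<open>n\<close> stay fixed, so the interval condition is always that of the whole graph.\<close>

lemma card_proper_colourings:
  assumes E: "natural_unit_interval_graph n E" and K: "finite K" and "k \<le> n"
  shows "int (card (proper_colourings k E K))
    = (\<Prod>j=1..k. int (card K) - int (card {i. i < j \<and> {i, j} \<in> E}))"
  using \<open>k \<le> n\<close>
proof (induction k)
  case 0
  \<comment> \<open>The zero vector is the only point of \<open>Rn 0\<close>, matching the empty
    product.\<close>
  have "proper_colourings 0 E K = {0}"
    by (auto simp: proper_colourings_def colourings_def Rn_def fun_eq_iff)
  then show ?case by simp
next
  case (Suc k)
  then show ?case using card_proper_colourings_Suc[OF E K, of k] by simp
qed

section \<open>Polynomial identity from values at natural numbers\<close>

lemma poly_eqI_nat:
  fixes p q :: "int poly"
  assumes "\<And>k::nat. poly p (int k) = poly q (int k)"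
  shows "p = q"
proof (rule ccontr)
  assume "p \<noteq> q"
  \<comment> \<open>A nonzero difference has finitely many roots, yet every natural number would be
    one.\<close>
  then have "finite {x. poly (p - q) x = 0}" by (intro poly_roots_finite) simp
  moreover have "range int \<subseteq> {x. poly (p - q) x = 0}" using assms by auto
  ultimately have "finite (range int)" by (rule rev_finite_subset)
  then show False using finite_imageD[OF _ inj_of_nat] by blast
qed

theorem corollary5p3:
  fixes n :: nat and E :: "nat set set" and c :: "nat \<Rightarrow> nat"
  assumes "natural_unit_interval_graph n E"
    and "\<And>j. j \<in> {1..n} \<Longrightarrow> c j = card {i. i < j \<and> {i, j} \<in> E}"
  shows "characteristic_poly n (graphical_arrangement n E) = (\<Prod>j=1..n. [:- int (c j), 1:])"
proof (rule poly_eqI_nat)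
  fix q :: nat
  \<comment> \<open>The reals 0, ..., \<open>q\<close> - 1 serve as a palette of exactly
    \<open>q\<close> colours.\<close>
  define K where "K = real ` {..<q}"
  have K: "finite K" "card K = q"
    by (auto simp: K_def card_image inj_on_def)
  have "poly (characteristic_poly n (graphical_arrangement n E)) (int q)
      = int (card (proper_colourings n E K))"
    using poly_characteristic_poly[of n E K] assms(1) K
    by (simp add: natural_unit_interval_graph_def)
  also have "\<dots> = (\<Prod>j=1..n. int q - int (c j))"
    using card_proper_colourings[OF assms(1) K(1), of n] assms(2) K(2) by simp
  also have "\<dots> = poly (\<Prod>j=1..n. [:- int (c j), 1:]) (int q)"
    by (simp add: poly_prod)
  finally show "poly (characteristic_poly n (graphical_arrangement n E)) (int q)
      = poly (\<Prod>j=1..n. [:- int (c j), 1:]) (int q)" .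
qed

end
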